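(* The symmetric monoidal category $\mathbf{Lens}$ of lenses between pairs of nonempty sets, with dualisable morphisms the adaptors $\mathbf{Lens}_d$, duality $(X,S)^*=(S,X)$, $(f,g)^*=(g,f)$, and counits $\epsilon_{(X,S)}:(X\times S,S\times X)\to(1,1)$ given by the unique view function $X\times S\to 1$ and the update function $((x,s),* )\mapsto(s,x)$, is a teleological category.
   Context: **Lenses.** Objects of $\mathbf{Lens}$ are pairs $(X,S)$ of nonempty sets. A morphism (lens) $\lambda:(X,S)\to(Y,R)$ is a pair of functions $v_\lambda:X\to Y$ (view) and $u_\lambda:X\times R\to S$ (update). The identity has $v=\mathrm{id}_X$, $u=\pi_2:X\times S\to S$. The composite of $\lambda:(X,S)\to(Y,R)$ and $\mu:(Y,R)\to(Z,Q)$ has $v_{\mu\circ\lambda}=v_\mu\circ v_\lambda$ and $u_{\mu\circ\lambda}(x,q)=u_\lambda(x,u_\mu(v_\lambda(x),q))$. The monoidal unit is $(1,1)$ and $(X,S)\otimes(X',S')=(X\times X',S\times S')$, with $v_{\lambda\otimes\mu}(x,x')=(v_\lambda(x),v_\mu(x'))$ and $u_{\lambda\otimes\mu}((x,x'),(r,r'))=(u_\lambda(x,r),u_\mu(x',r'))$; the structure morphisms are those induced by the evident bijections of cartesian products. **Adaptors.** An adaptor is a lens $\lambda:(X,S)\to(Y,R)$ whose update function factorises as $X\times R\xrightarrow{\pi_2}R\to S$. Given $f:X\to Y$ and $g:R\to S$, $(f,g):(X,S)\to(Y,R)$ denotes the unique adaptor with view $f$ and update $g\circ\pi_2$; since sets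 are nonempty every adaptor is $(f,g)$ for unique $f,g$. $\mathbf{Lens}_d$ is the wide subcategory of adaptors. **Teleological categories.** Write $\sigma_{A,B}:A\otimes B\to B\otimes A$ for the symmetry. A teleological category is a symmetric monoidal category $\mathcal C$ with unit $I$, together with: (i) a wide symmetric monoidal subcategory $\mathcal C_d$ of dualisable morphisms (it contains all objects, all identities and structure morphisms, and is closed under composition and $\otimes$), with an involutive symmetric monoidal functor $(-)^*:\mathcal C_d^{\mathrm{op}}\to\mathcal C_d$, so $(X^* )^*=X$, $(f^* )^*=f$, $I^*=I$, $(X\otimes Y)^*=X^*\otimes Y^*$, $(f\otimes g)^*=f^*\otimes g^*$, and duals of structure morphisms are the corresponding structure morphisms on dual objects; (ii) morphisms $\epsilon_X:X\otimes X^*\to I$ of $\mathcal C$ for every object $X$, extranatural: $\epsilon_Y\circ(f\otimes\mathrm{id}_{Y^*})=\epsilon_X\circ(\mathrm{id}_X\otimes f^* )$ for every dualisable $f:X\to Y$; such that (suppressing associators) $\epsilon_{X^*}=\epsilon_X\circ\sigma_{X^*,X}$ and $\epsilon_{X\otimes Y}=(\epsilon_X\otimes\epsilon_Y)\circ(\mathrm{id}_X\otimes\sigma_{Y,X^*}\otimes\mathrm{id}_{Y^*})$ for all $X,Y$. *)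

theory Defs
  imports Main "HOL-Library.FuncSet"
begin

section \<open>Symmetric monoidal categories\<close>

record ('o, 'm) smc =
  Ob :: "'o set"
  Ar :: "'m set"
  dom :: "'m \<Rightarrow> 'o"
  cod :: "'m \<Rightarrow> 'o"
  ident :: "'o \<Rightarrow> 'm" ("id\<index>")
  cmp :: "'m \<Rightarrow> 'm \<Rightarrow> 'm" (infixl "\<cdot>\<index>" 60)
  unit_ob :: "'o" ("\<one>\<index>")
  tensor_ob :: "'o \<Rightarrow> 'o \<Rightarrow> 'o" (infixl "\<otimes>\<index>" 70)
  tensor_ar :: "'m \<Rightarrow> 'm \<Rightarrow> 'm" (infixl "\<odot>\<index>" 70)
  associator :: "'o \<Rightarrow> 'o \<Rightarrow> 'o \<Rightarrow> 'm" ("\<alpha>\<index>")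
  lunitor :: "'o \<Rightarrow> 'm" ("\<l>\<index>")
  runitor :: "'o \<Rightarrow> 'm" ("\<r>\<index>")
  symmetry :: "'o \<Rightarrow> 'o \<Rightarrow> 'm" ("\<sigma>\<index>")

definition hom :: "('o, 'm, 'e) smc_scheme \<Rightarrow> 'o \<Rightarrow> 'o \<Rightarrow> 'm set" where
  "hom C A B = {f \<in> Ar C. dom C f = A \<and> cod C f = B}"

definition inverse_arrows :: "('o, 'm, 'e) smc_scheme \<Rightarrow> 'm \<Rightarrow> 'm \<Rightarrow> bool" where
  "inverse_arrows C f g \<longleftrightarrow>
     f \<in> Ar C \<and> g \<in> hom C (cod C f) (dom C f) \<and>
     g \<cdot>\<^bsub>C\<^esub> f = id\<^bsub>C\<^esub> (dom C f) \<and> f \<cdot>\<^bsub>C\<^esub> g = id\<^bsub>C\<^esub> (cod C f)"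

definition iso :: "('o, 'm, 'e) smc_scheme \<Rightarrow> 'm \<Rightarrow> bool" where
  "iso C f \<longleftrightarrow> (\<exists>g. inverse_arrows C f g)"

definition inv_ar :: "('o, 'm, 'e) smc_scheme \<Rightarrow> 'm \<Rightarrow> 'm" where
  "inv_ar C f = (THE g. inverse_arrows C f g)"

locale category =
  fixes C :: "('o, 'm, 'e) smc_scheme" (structure)
  assumes dom_Ob: "f \<in> Ar C \<Longrightarrow> dom C f \<in> Ob C"
    and cod_Ob: "f \<in> Ar C \<Longrightarrow> cod C f \<in> Ob C"
    and ident_hom: "A \<in> Ob C \<Longrightarrow> id A \<in> hom C A A"
    and cmp_hom: "\<lbrakk>f \<in> hom C A B; g \<in> hom C B D\<rbrakk> \<Longrightarrow> g \<cdot> f \<in> hom C A D"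
    and cmp_ident_left: "f \<in> hom C A B \<Longrightarrow> id B \<cdot> f = f"
    and cmp_ident_right: "f \<in> hom C A B \<Longrightarrow> f \<cdot> id A = f"
    and cmp_assoc: "\<lbrakk>f \<in> hom C A B; g \<in> hom C B D; h \<in> hom C D E\<rbrakk>
          \<Longrightarrow> (h \<cdot> g) \<cdot> f = h \<cdot> (g \<cdot> f)"

locale symmetric_monoidal_category = category C
  for C :: "('o, 'm, 'e) smc_scheme" (structure) +
  assumes unit_Ob: "\<one> \<in> Ob C"
    and tensor_Ob: "\<lbrakk>A \<in> Ob C; B \<in> Ob C\<rbrakk> \<Longrightarrow> A \<otimes> B \<in> Ob C"
    and tensor_hom: "\<lbrakk>f \<in> hom C A B; g \<in> hom C A' B'\<rbrakk> \<Longrightarrow> f \<odot> g \<in> hom C (A \<otimes> A') (B \<otimes> B')"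
    and tensor_ident: "\<lbrakk>A \<in> Ob C; B \<in> Ob C\<rbrakk> \<Longrightarrow> id A \<odot> id B = id (A \<otimes> B)"
    and tensor_cmp: "\<lbrakk>f \<in> hom C A B; g \<in> hom C B D; f' \<in> hom C A' B'; g' \<in> hom C B' D'\<rbrakk>
          \<Longrightarrow> (g \<cdot> f) \<odot> (g' \<cdot> f') = (g \<odot> g') \<cdot> (f \<odot> f')"
    and associator_hom: "\<lbrakk>A \<in> Ob C; B \<in> Ob C; D \<in> Ob C\<rbrakk>
          \<Longrightarrow> \<alpha> A B D \<in> hom C ((A \<otimes> B) \<otimes> D) (A \<otimes> (B \<otimes> D))"
    and associator_iso: "\<lbrakk>A \<in> Ob C; B \<in> Ob C; D \<in> Ob C\<rbrakk> \<Longrightarrow> iso C (\<alpha> A B D)"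
    and associator_natural: "\<lbrakk>f \<in> hom C A A'; g \<in> hom C B B'; h \<in> hom C D D'\<rbrakk>
          \<Longrightarrow> \<alpha> A' B' D' \<cdot> ((f \<odot> g) \<odot> h) = (f \<odot> (g \<odot> h)) \<cdot> \<alpha> A B D"
    and lunitor_hom: "A \<in> Ob C \<Longrightarrow> \<l> A \<in> hom C (\<one> \<otimes> A) A"
    and lunitor_iso: "A \<in> Ob C \<Longrightarrow> iso C (\<l> A)"
    and lunitor_natural: "f \<in> hom C A B \<Longrightarrow> \<l> B \<cdot> (id \<one> \<odot> f) = f \<cdot> \<l> A"
    and runitor_hom: "A \<in> Ob C \<Longrightarrow> \<r> A \<in> hom C (A \<otimes> \<one>) A"
    and runitor_iso: "A \<in> Ob C \<Longrightarrow> iso C (\<r> A)"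
    and runitor_natural: "f \<in> hom C A B \<Longrightarrow> \<r> B \<cdot> (f \<odot> id \<one>) = f \<cdot> \<r> A"
    and symmetry_hom: "\<lbrakk>A \<in> Ob C; B \<in> Ob C\<rbrakk> \<Longrightarrow> \<sigma> A B \<in> hom C (A \<otimes> B) (B \<otimes> A)"
    and symmetry_natural: "\<lbrakk>f \<in> hom C A A'; g \<in> hom C B B'\<rbrakk>
          \<Longrightarrow> \<sigma> A' B' \<cdot> (f \<odot> g) = (g \<odot> f) \<cdot> \<sigma> A B"
    and symmetry_symmetry: "\<lbrakk>A \<in> Ob C; B \<in> Ob C\<rbrakk> \<Longrightarrow> \<sigma> B A \<cdot> \<sigma> A B = id (A \<otimes> B)"
    and pentagon: "\<lbrakk>A \<in> Ob C; B \<in> Ob C; D \<in> Ob C; E \<in> Ob C\<rbrakk>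
          \<Longrightarrow> \<alpha> A B (D \<otimes> E) \<cdot> \<alpha> (A \<otimes> B) D E
            = (id A \<odot> \<alpha> B D E) \<cdot> (\<alpha> A (B \<otimes> D) E \<cdot> (\<alpha> A B D \<odot> id E))"
    and triangle: "\<lbrakk>A \<in> Ob C; B \<in> Ob C\<rbrakk>
          \<Longrightarrow> (id A \<odot> \<l> B) \<cdot> \<alpha> A \<one> B = \<r> A \<odot> id B"
    and hexagon: "\<lbrakk>A \<in> Ob C; B \<in> Ob C; D \<in> Ob C\<rbrakk>
          \<Longrightarrow> \<alpha> B D A \<cdot> (\<sigma> A (B \<otimes> D) \<cdot> \<alpha> A B D)
            = (id B \<odot> \<sigma> A D) \<cdot> (\<alpha> B A D \<cdot> (\<sigma> A B \<odot> id D))"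


section \<open>Teleological categories\<close>

record ('o, 'm) teleological = "('o, 'm) smc" +
  Dl :: "'m set"
  dual_ob :: "'o \<Rightarrow> 'o"
  dual_ar :: "'m \<Rightarrow> 'm"
  counit :: "'o \<Rightarrow> 'm" ("\<epsilon>\<index>")

text \<open>
  The canonical isomorphism from (A B)(A' B') to (A A')(B B') that exchanges the two middle
  factors, with all associators written out.
\<close>

definition middle_exchange :: "('o, 'm, 'e) smc_scheme \<Rightarrow> 'o \<Rightarrow> 'o \<Rightarrow> 'o \<Rightarrow> 'o \<Rightarrow> 'm" where
  "middle_exchange C A B A' B' =
     inv_ar C (\<alpha>\<^bsub>C\<^esub> A A' (B \<otimes>\<^bsub>C\<^esub> B')) \<cdot>\<^bsub>C\<^esub>
     ((id\<^bsub>C\<^esub> A \<odot>\<^bsub>C\<^esub> \<alpha>\<^bsub>C\<^esub> A' B B') \<cdot>\<^bsub>C\<^esub>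
     ((id\<^bsub>C\<^esub> A \<odot>\<^bsub>C\<^esub> (\<sigma>\<^bsub>C\<^esub> B A' \<odot>\<^bsub>C\<^esub> id\<^bsub>C\<^esub> B')) \<cdot>\<^bsub>C\<^esub>
     ((id\<^bsub>C\<^esub> A \<odot>\<^bsub>C\<^esub> inv_ar C (\<alpha>\<^bsub>C\<^esub> B A' B')) \<cdot>\<^bsub>C\<^esub>
     \<alpha>\<^bsub>C\<^esub> A B (A' \<otimes>\<^bsub>C\<^esub> B'))))"

text \<open>
  Since the dual is contravariant, the dual of an associator or unitor is an arrow in the
  direction opposite to the structure arrow at the dual objects: it is the inverse of that arrow.
  In the law for the counit of a tensor product, the left unitor identifies the tensor square of
  the unit object with the unit object.
\<close>

locale teleological_category = symmetric_monoidal_category C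
  for C :: "('o, 'm, 'e) teleological_scheme" (structure) +
  assumes Dl_Ar: "Dl C \<subseteq> Ar C"
    and Dl_ident: "A \<in> Ob C \<Longrightarrow> id A \<in> Dl C"
    and Dl_cmp: "\<lbrakk>f \<in> Dl C; g \<in> Dl C; cod C f = dom C g\<rbrakk> \<Longrightarrow> g \<cdot> f \<in> Dl C"
    and Dl_tensor: "\<lbrakk>f \<in> Dl C; g \<in> Dl C\<rbrakk> \<Longrightarrow> f \<odot> g \<in> Dl C"
    and Dl_associator: "\<lbrakk>A \<in> Ob C; B \<in> Ob C; D \<in> Ob C\<rbrakk>
          \<Longrightarrow> \<alpha> A B D \<in> Dl C \<and> inv_ar C (\<alpha> A B D) \<in> Dl C"
    and Dl_lunitor: "A \<in> Ob C \<Longrightarrow> \<l> A \<in> Dl C \<and> inv_ar C (\<l> A) \<in> Dl C"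
    and Dl_runitor: "A \<in> Ob C \<Longrightarrow> \<r> A \<in> Dl C \<and> inv_ar C (\<r> A) \<in> Dl C"
    and Dl_symmetry: "\<lbrakk>A \<in> Ob C; B \<in> Ob C\<rbrakk> \<Longrightarrow> \<sigma> A B \<in> Dl C"
    and dual_Ob: "A \<in> Ob C \<Longrightarrow> dual_ob C A \<in> Ob C"
    and dual_Dl: "f \<in> Dl C \<Longrightarrow> dual_ar C f \<in> Dl C"
    and dual_hom: "\<lbrakk>f \<in> Dl C; f \<in> hom C A B\<rbrakk>
          \<Longrightarrow> dual_ar C f \<in> hom C (dual_ob C B) (dual_ob C A)"
    and dual_ident: "A \<in> Ob C \<Longrightarrow> dual_ar C (id A) = id (dual_ob C A)"
    and dual_cmp: "\<lbrakk>f \<in> Dl C; g \<in> Dl C; cod C f = dom C g\<rbrakk>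
          \<Longrightarrow> dual_ar C (g \<cdot> f) = dual_ar C f \<cdot> dual_ar C g"
    and dual_dual_ob: "A \<in> Ob C \<Longrightarrow> dual_ob C (dual_ob C A) = A"
    and dual_dual_ar: "f \<in> Dl C \<Longrightarrow> dual_ar C (dual_ar C f) = f"
    and dual_unit: "dual_ob C \<one> = \<one>"
    and dual_tensor_ob: "\<lbrakk>A \<in> Ob C; B \<in> Ob C\<rbrakk>
          \<Longrightarrow> dual_ob C (A \<otimes> B) = dual_ob C A \<otimes> dual_ob C B"
    and dual_tensor_ar: "\<lbrakk>f \<in> Dl C; g \<in> Dl C\<rbrakk>
          \<Longrightarrow> dual_ar C (f \<odot> g) = dual_ar C f \<odot> dual_ar C g"
    and dual_associator: "\<lbrakk>A \<in> Ob C; B \<in> Ob C; D \<in> Ob C\<rbrakk>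
          \<Longrightarrow> dual_ar C (\<alpha> A B D) = inv_ar C (\<alpha> (dual_ob C A) (dual_ob C B) (dual_ob C D))"
    and dual_lunitor: "A \<in> Ob C \<Longrightarrow> dual_ar C (\<l> A) = inv_ar C (\<l> (dual_ob C A))"
    and dual_runitor: "A \<in> Ob C \<Longrightarrow> dual_ar C (\<r> A) = inv_ar C (\<r> (dual_ob C A))"
    and dual_symmetry: "\<lbrakk>A \<in> Ob C; B \<in> Ob C\<rbrakk>
          \<Longrightarrow> dual_ar C (\<sigma> A B) = \<sigma> (dual_ob C B) (dual_ob C A)"
    and counit_hom: "A \<in> Ob C \<Longrightarrow> \<epsilon> A \<in> hom C (A \<otimes> dual_ob C A) \<one>"
    and counit_extranatural: "\<lbrakk>f \<in> Dl C; f \<in> hom C A B\<rbrakk>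
          \<Longrightarrow> \<epsilon> B \<cdot> (f \<odot> id (dual_ob C B)) = \<epsilon> A \<cdot> (id A \<odot> dual_ar C f)"
    and counit_dual: "A \<in> Ob C \<Longrightarrow> \<epsilon> (dual_ob C A) = \<epsilon> A \<cdot> \<sigma> (dual_ob C A) A"
    and counit_tensor: "\<lbrakk>A \<in> Ob C; B \<in> Ob C\<rbrakk>
          \<Longrightarrow> \<epsilon> (A \<otimes> B) =
              \<l> \<one> \<cdot> ((\<epsilon> A \<odot> \<epsilon> B) \<cdot> middle_exchange C A B (dual_ob C A) (dual_ob C B))"


section \<open>Universes of sets\<close>

text \<open>
  There is no type of all sets, so the sets are those of a universe: a collection \<open>U\<close> of
  subsets of a type that contains a one-point set and is closed under binary cartesian products,
  where ordered pairs are encoded in the type by an injection. Nothing else is needed to form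
  the category of lenses, and \<open>U\<close> is otherwise arbitrary.
\<close>

locale set_universe =
  fixes U :: "'u set set" and pair :: "'u \<times> 'u \<Rightarrow> 'u" and pt :: 'u
  assumes inj_pair: "inj pair"
    and one_in_U: "{pt} \<in> U"
    and times_in_U: "\<lbrakk>X \<in> U; Y \<in> U\<rbrakk> \<Longrightarrow> pair ` (X \<times> Y) \<in> U"

text \<open>The subsets of any given type occur, up to bijection, in some universe.\<close>

datatype 'a tuple = Atom 'a | Point | Tuple "'a tuple \<times> 'a tuple"

lemma set_universe_tuple: "set_universe UNIV Tuple (Point :: 'a tuple)"
  by standard (auto intro: injI)


section \<open>Lenses\<close>

text \<open>
  A lens carries its source and target. View and update are extensional functions
  (\<open>undefined\<close> outside their domains), so that equality of lenses is equality of the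
  functions on their domains. The update is defined on a product of the ambient logic; products
  that occur inside objects are encoded by \<open>pair\<close>.
\<close>

datatype 'u lens =
  MkLens (src: "'u set \<times> 'u set") (tgt: "'u set \<times> 'u set")
    (view: "'u \<Rightarrow> 'u") (upd: "'u \<times> 'u \<Rightarrow> 'u")

definition lens_id :: "'u set \<times> 'u set \<Rightarrow> 'u lens" where
  "lens_id A = MkLens A A (\<lambda>x\<in>fst A. x) (\<lambda>p\<in>fst A \<times> snd A. snd p)"

text \<open>\<open>lens_comp \<mu> \<lambda>\<close> is \<open>\<mu>\<close> after \<open>\<lambda>\<close>.\<close>

definition lens_comp :: "'u lens \<Rightarrow> 'u lens \<Rightarrow> 'u lens" where
  "lens_comp m l = MkLens (src l) (tgt m)
     (\<lambda>x\<in>fst (src l). view m (view l x))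
     (\<lambda>(x, q)\<in>fst (src l) \<times> snd (tgt m). upd l (x, upd m (view l x, q)))"

text \<open>The adaptor (f, g) from A = (X, S) to B = (Y, R), where f maps X to Y and g maps R to S.\<close>

definition adaptor ::
    "'u set \<times> 'u set \<Rightarrow> 'u set \<times> 'u set \<Rightarrow> ('u \<Rightarrow> 'u) \<Rightarrow> ('u \<Rightarrow> 'u) \<Rightarrow> 'u lens" where
  "adaptor A B f g = MkLens A B (\<lambda>x\<in>fst A. f x) (\<lambda>p\<in>fst A \<times> snd B. g (snd p))"

text \<open>The function g of an adaptor (f, g); it is unique because \<open>fst (src l)\<close> is nonempty.\<close>

definition adaptor_back :: "'u lens \<Rightarrow> 'u \<Rightarrow> 'u" where
  "adaptor_back l = (THE g. g \<in> snd (tgt l) \<rightarrow>\<^sub>E snd (src l) \<and>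
     (\<forall>x\<in>fst (src l). \<forall>r\<in>snd (tgt l). upd l (x, r) = g r))"

context set_universe
begin

definition lens_obj :: "('u set \<times> 'u set) set" where
  "lens_obj = {(X, S). X \<in> U \<and> S \<in> U \<and> X \<noteq> {} \<and> S \<noteq> {}}"

definition lens_arr :: "'u lens set" where
  "lens_arr = {l. src l \<in> lens_obj \<and> tgt l \<in> lens_obj \<and>
     view l \<in> fst (src l) \<rightarrow>\<^sub>E fst (tgt l) \<and>
     upd l \<in> fst (src l) \<times> snd (tgt l) \<rightarrow>\<^sub>E snd (src l)}"

definition adaptors :: "'u lens set" where
  "adaptors = {l \<in> lens_arr. \<exists>g \<in> snd (tgt l) \<rightarrow> snd (src l).
     \<forall>x\<in>fst (src l). \<forall>r\<in>snd (tgt l). upd l (x, r) = g r}"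

definition unpair :: "'u \<Rightarrow> 'u \<times> 'u" where
  "unpair = inv pair"

definition lens_unit :: "'u set \<times> 'u set" where
  "lens_unit = ({pt}, {pt})"

definition lens_tensor_ob :: "'u set \<times> 'u set \<Rightarrow> 'u set \<times> 'u set \<Rightarrow> 'u set \<times> 'u set" where
  "lens_tensor_ob A B = (pair ` (fst A \<times> fst B), pair ` (snd A \<times> snd B))"

definition lens_tensor_ar :: "'u lens \<Rightarrow> 'u lens \<Rightarrow> 'u lens" where
  "lens_tensor_ar l m =
     (let A = lens_tensor_ob (src l) (src m); B = lens_tensor_ob (tgt l) (tgt m) in
      MkLens A B
        (\<lambda>p\<in>fst A. case unpair p of (x, x') \<Rightarrow> pair (view l x, view m x'))
        (\<lambda>(p, q)\<in>fst A \<times> snd B. case (unpair p, unpair q) of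
           ((x, x'), (r, r')) \<Rightarrow> pair (upd l (x, r), upd m (x', r'))))"

definition assoc_right :: "'u \<Rightarrow> 'u" where
  "assoc_right p = (case unpair p of (q, z) \<Rightarrow> case unpair q of (x, y) \<Rightarrow> pair (x, pair (y, z)))"

definition assoc_left :: "'u \<Rightarrow> 'u" where
  "assoc_left p = (case unpair p of (x, q) \<Rightarrow> case unpair q of (y, z) \<Rightarrow> pair (pair (x, y), z))"

definition swap :: "'u \<Rightarrow> 'u" where
  "swap p = (case unpair p of (x, y) \<Rightarrow> pair (y, x))"

definition lens_associator ::
    "'u set \<times> 'u set \<Rightarrow> 'u set \<times> 'u set \<Rightarrow> 'u set \<times> 'u set \<Rightarrow> 'u lens" where
  "lens_associator A B D =
     adaptor (lens_tensor_ob (lens_tensor_ob A B) D) (lens_tensor_ob A (lens_tensor_ob B D))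
       assoc_right assoc_left"

definition lens_lunitor :: "'u set \<times> 'u set \<Rightarrow> 'u lens" where
  "lens_lunitor A =
     adaptor (lens_tensor_ob lens_unit A) A (\<lambda>p. snd (unpair p)) (\<lambda>s. pair (pt, s))"

definition lens_runitor :: "'u set \<times> 'u set \<Rightarrow> 'u lens" where
  "lens_runitor A =
     adaptor (lens_tensor_ob A lens_unit) A (\<lambda>p. fst (unpair p)) (\<lambda>s. pair (s, pt))"

definition lens_symmetry :: "'u set \<times> 'u set \<Rightarrow> 'u set \<times> 'u set \<Rightarrow> 'u lens" where
  "lens_symmetry A B = adaptor (lens_tensor_ob A B) (lens_tensor_ob B A) swap swap"

definition lens_dual_ob :: "'u set \<times> 'u set \<Rightarrow> 'u set \<times> 'u set" where
  "lens_dual_ob A = (snd A, fst A)"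

definition lens_dual_ar :: "'u lens \<Rightarrow> 'u lens" where
  "lens_dual_ar l =
     adaptor (lens_dual_ob (tgt l)) (lens_dual_ob (src l)) (adaptor_back l) (view l)"

definition lens_counit :: "'u set \<times> 'u set \<Rightarrow> 'u lens" where
  "lens_counit A =
     (let P = lens_tensor_ob A (lens_dual_ob A) in
      MkLens P lens_unit (\<lambda>p\<in>fst P. pt) (\<lambda>(p, t)\<in>fst P \<times> {pt}. swap p))"

definition Lens :: "('u set \<times> 'u set, 'u lens) teleological" where
  "Lens =
    \<lparr> Ob = lens_obj, Ar = lens_arr, dom = src, cod = tgt,
      ident = lens_id, cmp = lens_comp,
      unit_ob = lens_unit, tensor_ob = lens_tensor_ob, tensor_ar = lens_tensor_ar,
      associator = lens_associator, lunitor = lens_lunitor, runitor = lens_runitor,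
      symmetry = lens_symmetry,
      Dl = adaptors, dual_ob = lens_dual_ob, dual_ar = lens_dual_ar, counit = lens_counit \<rparr>"

end

end

theory Submission
  imports Defs
begin

text \<open>
  An adaptor is a pair of functions, forward and backward, and on such pairs composition, tensor
  and dual act componentwise, the dual exchanging the two. All structure arrows are adaptors, so
  the coherence laws and the laws of the dual reduce to identities between rearrangements of
  tuples. Only functoriality of the tensor, naturality and the laws of the counit involve
  arbitrary lenses; there views and updates are compared pointwise.
\<close>

text \<open>Inverses are unique, so any explicit inverse evaluates the definite description
  \<open>inv_ar\<close>. The associators and unitors below are inverted in this way.\<close>

lemma (in category) inv_ar_eq:
  assumes "inverse_arrows C f g"
  shows "inv_ar C f = g"
  unfolding inv_ar_def
proof (rule the_equality)
  show "inverse_arrows C f g" by (rule assms)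
  fix h assume h: "inverse_arrows C f h"
  have f: "f \<in> hom C (dom C f) (cod C f)"
    using assms by (simp add: inverse_arrows_def hom_def)
  have g: "g \<in> hom C (cod C f) (dom C f)" and h': "h \<in> hom C (cod C f) (dom C f)"
    using assms h by (auto simp: inverse_arrows_def)
  have "h = h \<cdot> (f \<cdot> g)"
    using assms cmp_ident_right[OF h'] by (simp add: inverse_arrows_def)
  also have "\<dots> = (h \<cdot> f) \<cdot> g"
    by (rule cmp_assoc[OF g f h', symmetric])
  also have "\<dots> = g"
    using h cmp_ident_left[OF g] by (simp add: inverse_arrows_def)
  finally show "h = g" .
qed

context set_universe
begin

section \<open>Evaluation of the record fields and of encoded pairs\<close>

lemma Lens_simps [simp]:
  "Ob Lens = lens_obj" "Ar Lens = lens_arr" "dom Lens = src" "cod Lens = tgt"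
  "ident Lens = lens_id" "cmp Lens = lens_comp"
  "unit_ob Lens = lens_unit" "tensor_ob Lens = lens_tensor_ob" "tensor_ar Lens = lens_tensor_ar"
  "associator Lens = lens_associator" "lunitor Lens = lens_lunitor" "runitor Lens = lens_runitor"
  "symmetry Lens = lens_symmetry"
  "Dl Lens = adaptors" "dual_ob Lens = lens_dual_ob" "dual_ar Lens = lens_dual_ar"
  "counit Lens = lens_counit"
  by (simp_all add: Lens_def)

lemma unpair_pair [simp]: "unpair (pair p) = p"
  by (simp add: unpair_def inj_pair)

lemma pair_eq_iff [simp]: "pair p = pair q \<longleftrightarrow> p = q"
  using inj_pair by (simp add: inj_eq)

lemma pair_in_image_iff [simp]: "pair p \<in> pair ` P \<longleftrightarrow> p \<in> P"
  by auto

lemma shuffle_pair [simp]: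
  "swap (pair (x, y)) = pair (y, x)"
  "assoc_right (pair (pair (x, y), z)) = pair (x, pair (y, z))"
  "assoc_left (pair (x, pair (y, z))) = pair (pair (x, y), z)"
  by (simp_all add: swap_def assoc_right_def assoc_left_def)


subsection \<open>Objects and hom-sets\<close>

lemma tensor_ob_simps [simp]:
  "fst (lens_tensor_ob A B) = pair ` (fst A \<times> fst B)"
  "snd (lens_tensor_ob A B) = pair ` (snd A \<times> snd B)"
  by (simp_all add: lens_tensor_ob_def)

lemma unit_simps [simp]: "fst lens_unit = {pt}" "snd lens_unit = {pt}"
  by (simp_all add: lens_unit_def)

lemma dual_ob_simps [simp]:
  "fst (lens_dual_ob A) = snd A" "snd (lens_dual_ob A) = fst A"
  "lens_dual_ob (lens_dual_ob A) = A"
  "lens_dual_ob lens_unit = lens_unit"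
  "lens_dual_ob (lens_tensor_ob A B) = lens_tensor_ob (lens_dual_ob A) (lens_dual_ob B)"
  by (simp_all add: lens_dual_ob_def lens_unit_def lens_tensor_ob_def)

lemma obj_closed [simp]:
  "lens_unit \<in> lens_obj"
  "\<lbrakk>A \<in> lens_obj; B \<in> lens_obj\<rbrakk> \<Longrightarrow> lens_tensor_ob A B \<in> lens_obj"
  "A \<in> lens_obj \<Longrightarrow> lens_dual_ob A \<in> lens_obj"
  by (auto simp: lens_obj_def lens_unit_def lens_tensor_ob_def lens_dual_ob_def
      one_in_U times_in_U)

lemma obj_nonempty:
  assumes "A \<in> lens_obj"
  shows "fst A \<noteq> {}" "snd A \<noteq> {}"
  using assms by (auto simp: lens_obj_def)

lemma hom_iff:
  "l \<in> hom Lens A B \<longleftrightarrow> A \<in> lens_obj \<and> B \<in> lens_obj \<and> src l = A \<and> tgt l = B \<and>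
     view l \<in> fst A \<rightarrow>\<^sub>E fst B \<and> upd l \<in> fst A \<times> snd B \<rightarrow>\<^sub>E snd A"
  by (auto simp: hom_def lens_arr_def)

lemma hom_simps:
  assumes "l \<in> hom Lens A B"
  shows "A \<in> lens_obj" "B \<in> lens_obj" "src l = A" "tgt l = B"
    "x \<in> fst A \<Longrightarrow> view l x \<in> fst B"
    "x \<in> fst A \<Longrightarrow> r \<in> snd B \<Longrightarrow> upd l (x, r) \<in> snd A"
  using assms by (auto simp: hom_iff)

text \<open>Views and updates are extensional and membership in a hom-set fixes source and target,
  so agreement on the domains already forces equality. All comparisons of arbitrary lenses rest on
  this.\<close>

lemma hom_eqI:
  assumes "l \<in> hom Lens A B" "m \<in> hom Lens A B"
    and "\<And>x. x \<in> fst A \<Longrightarrow> view l x = view m x"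
    and "\<And>x r. x \<in> fst A \<Longrightarrow> r \<in> snd B \<Longrightarrow> upd l (x, r) = upd m (x, r)"
  shows "l = m"
proof (rule lens.expand, intro conjI)
  show "view l = view m"
    using assms(1-3) by (auto simp: hom_iff intro: PiE_ext)
  show "upd l = upd m"
    using assms(1,2,4)
    by (intro PiE_ext[of _ "fst A \<times> snd B" "\<lambda>_. snd A"]) (auto simp: hom_iff)
qed (use assms in \<open>auto simp: hom_iff\<close>)

lemma comp_hom:
  assumes "l \<in> hom Lens A B" "m \<in> hom Lens B D"
  shows "lens_comp m l \<in> hom Lens A D"
  using assms by (auto simp: hom_iff lens_comp_def)

lemma comp_simps:
  assumes "l \<in> hom Lens A B" "m \<in> hom Lens B D"
  shows "x \<in> fst A \<Longrightarrow> view (lens_comp m l) x = view m (view l x)"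
    and "x \<in> fst A \<Longrightarrow> q \<in> snd D \<Longrightarrow>
           upd (lens_comp m l) (x, q) = upd l (x, upd m (view l x, q))"
  using assms by (auto simp: hom_iff lens_comp_def)

lemma tensor_ar_hom:
  assumes "l \<in> hom Lens A B" "m \<in> hom Lens A' B'"
  shows "lens_tensor_ar l m \<in> hom Lens (lens_tensor_ob A A') (lens_tensor_ob B B')"
  using assms by (auto simp: hom_iff lens_tensor_ar_def Let_def)

lemma tensor_ar_simps:
  assumes "l \<in> hom Lens A B" "m \<in> hom Lens A' B'"
  shows "x \<in> fst A \<Longrightarrow> x' \<in> fst A' \<Longrightarrow>
           view (lens_tensor_ar l m) (pair (x, x')) = pair (view l x, view m x')"
    and "x \<in> fst A \<Longrightarrow> x' \<in> fst A' \<Longrightarrow> r \<in> snd B \<Longrightarrow> r' \<in> snd B' \<Longrightarrow>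
           upd (lens_tensor_ar l m) (pair (x, x'), pair (r, r')) =
             pair (upd l (x, r), upd m (x', r'))"
  using assms by (auto simp: hom_iff lens_tensor_ar_def Let_def)

lemma counit_hom:
  assumes "A \<in> lens_obj"
  shows "lens_counit A \<in> hom Lens (lens_tensor_ob A (lens_dual_ob A)) lens_unit"
  using assms by (auto simp: hom_iff lens_counit_def Let_def)

text \<open>In contrast to an adaptor, the update reads the point \<open>p\<close> and ignores the
  trivial feedback \<open>pt\<close>. For A = (X, S) the two sides of the source are X \<times> S
  and S \<times> X, whence the swap.\<close>

lemma counit_simps:
  "p \<in> pair ` (fst A \<times> snd A) \<Longrightarrow> view (lens_counit A) p = pt"
  "p \<in> pair ` (fst A \<times> snd A) \<Longrightarrow> upd (lens_counit A) (p, pt) = swap p"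
  by (auto simp: lens_counit_def Let_def)


subsection \<open>Adaptors\<close>

text \<open>\<open>adaptor\<close> restricts both functions itself, so membership in the plain
  function space is enough to obtain extensional view and update.\<close>

lemma adaptor_hom:
  assumes "A \<in> lens_obj" "B \<in> lens_obj" "f \<in> fst A \<rightarrow> fst B" "g \<in> snd B \<rightarrow> snd A"
  shows "adaptor A B f g \<in> hom Lens A B"
  using assms by (auto simp: hom_iff adaptor_def)

lemma adaptor_simps [simp]:
  "src (adaptor A B f g) = A" "tgt (adaptor A B f g) = B"
  "x \<in> fst A \<Longrightarrow> view (adaptor A B f g) x = f x"
  "x \<in> fst A \<Longrightarrow> r \<in> snd B \<Longrightarrow> upd (adaptor A B f g) (x, r) = g r"
  by (auto simp: adaptor_def)

text \<open>Reduces an equation of adaptors with common source and target to two equations of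
  functions on tuples; the coherence laws are proved in this form.\<close>

lemma adaptor_cong:
  assumes "\<And>x. x \<in> fst A \<Longrightarrow> f x = f' x" "\<And>r. r \<in> snd B \<Longrightarrow> g r = g' r"
  shows "adaptor A B f g = adaptor A B f' g'"
  using assms by (auto simp: adaptor_def intro!: restrict_ext)

lemma adaptor_in_adaptors:
  assumes "A \<in> lens_obj" "B \<in> lens_obj" "f \<in> fst A \<rightarrow> fst B" "g \<in> snd B \<rightarrow> snd A"
  shows "adaptor A B f g \<in> adaptors"
  using adaptor_hom[OF assms] assms(4)
  by (auto simp: adaptors_def hom_def intro!: bexI[of _ g])

text \<open>The forward function is the view, the backward one the given factor of the update.
  Extensionality identifies the lens with the adaptor so formed.\<close>

lemma adaptorsE:
  assumes "l \<in> adaptors"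
  obtains A B f g where "A \<in> lens_obj" "B \<in> lens_obj" "f \<in> fst A \<rightarrow> fst B" "g \<in> snd B \<rightarrow> snd A"
    "l = adaptor A B f g"
proof -
  obtain g where l: "l \<in> hom Lens (src l) (tgt l)" and g: "g \<in> snd (tgt l) \<rightarrow> snd (src l)"
    and upd: "\<And>x r. x \<in> fst (src l) \<Longrightarrow> r \<in> snd (tgt l) \<Longrightarrow> upd l (x, r) = g r"
    using assms by (auto simp: adaptors_def hom_def)
  have f: "view l \<in> fst (src l) \<rightarrow> fst (tgt l)"
    using hom_simps[OF l] by auto
  show thesis
    by (rule that[OF hom_simps(1)[OF l] hom_simps(2)[OF l] f g], rule hom_eqI[OF l adaptor_hom])
      (use hom_simps[OF l] f g upd in auto)
qed

lemma id_adaptor: "lens_id A = adaptor A A (\<lambda>x. x) (\<lambda>s. s)"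
  by (simp add: lens_id_def adaptor_def)

lemma id_hom: "A \<in> lens_obj \<Longrightarrow> lens_id A \<in> hom Lens A A"
  by (simp add: id_adaptor adaptor_hom)

text \<open>Feedback travels from D back to A, so the backward functions compose in reverse. The
  hypotheses place the inner values in the sets to which the outer functions are restricted.\<close>

lemma comp_adaptor:
  assumes "f \<in> fst A \<rightarrow> fst B" "g' \<in> snd D \<rightarrow> snd B"
  shows "lens_comp (adaptor B D f' g') (adaptor A B f g) = adaptor A D (\<lambda>x. f' (f x)) (\<lambda>q. g (g' q))"
  using assms by (auto simp: lens_comp_def adaptor_def intro!: restrict_ext)

text \<open>The product map f \<times> g transported along the encoding \<open>pair\<close>; it
  keeps tensors of adaptors in the form of an adaptor.\<close>

definition cross :: "('u \<Rightarrow> 'u) \<Rightarrow> ('u \<Rightarrow> 'u) \<Rightarrow> 'u \<Rightarrow> 'u" where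
  "cross f g p = pair (map_prod f g (unpair p))"

lemma cross_pair [simp]: "cross f g (pair (x, y)) = pair (f x, g y)"
  by (simp add: cross_def)

lemma tensor_adaptor:
  "lens_tensor_ar (adaptor A B f g) (adaptor A' B' f' g') =
     adaptor (lens_tensor_ob A A') (lens_tensor_ob B B') (cross f f') (cross g g')"
  by (auto simp: lens_tensor_ar_def adaptor_def Let_def intro!: restrict_ext)

lemma adaptor_back_adaptor:
  assumes "A \<in> lens_obj" "g \<in> snd B \<rightarrow> snd A"
  shows "adaptor_back (adaptor A B f g) = restrict g (snd B)"
  unfolding adaptor_back_def
proof (rule the_equality)
  \<comment> \<open>Nonemptiness of objects enters here: over an empty \<open>fst A\<close> every
    candidate would satisfy the condition that defines \<open>adaptor_back\<close>. A point
    \<open>x\<close> pins down the value at each \<open>r\<close>.\<close>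
  obtain x where x: "x \<in> fst A"
    using obj_nonempty[OF assms(1)] by blast
  fix h assume "h \<in> snd (tgt (adaptor A B f g)) \<rightarrow>\<^sub>E snd (src (adaptor A B f g)) \<and>
    (\<forall>x\<in>fst (src (adaptor A B f g)). \<forall>r\<in>snd (tgt (adaptor A B f g)).
      upd (adaptor A B f g) (x, r) = h r)"
  then have h: "h \<in> snd B \<rightarrow>\<^sub>E snd A" and "\<forall>x\<in>fst A. \<forall>r\<in>snd B. g r = h r"
    by simp_all
  then show "h = restrict g (snd B)"
    using x by (auto simp: fun_eq_iff PiE_def extensional_def)
qed (use assms in auto)

text \<open>The view and \<open>adaptor_back\<close> return the two functions restricted to their
  domains; forming an adaptor restricts again, so these restrictions disappear.\<close>

lemma dual_adaptor:
  assumes "A \<in> lens_obj" "g \<in> snd B \<rightarrow> snd A"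
  shows "lens_dual_ar (adaptor A B f g) = adaptor (lens_dual_ob B) (lens_dual_ob A) g f"
  unfolding lens_dual_ar_def
  by (auto simp: adaptor_back_adaptor[OF assms] intro: adaptor_cong)

section \<open>Invertible adaptors and the structure arrows\<close>

lemma inverse_arrows_adaptor:
  assumes "A \<in> lens_obj" "B \<in> lens_obj" "f \<in> fst A \<rightarrow> fst B" "g \<in> snd B \<rightarrow> snd A"
    "f' \<in> fst B \<rightarrow> fst A" "g' \<in> snd A \<rightarrow> snd B"
    "\<And>x. x \<in> fst A \<Longrightarrow> f' (f x) = x" "\<And>y. y \<in> fst B \<Longrightarrow> f (f' y) = y"
    "\<And>s. s \<in> snd A \<Longrightarrow> g (g' s) = s" "\<And>r. r \<in> snd B \<Longrightarrow> g' (g r) = r"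
  shows "inverse_arrows Lens (adaptor A B f g) (adaptor B A f' g')"
  using assms adaptor_hom[of A B f g] adaptor_hom[of B A f' g']
  by (auto simp: inverse_arrows_def comp_adaptor id_adaptor hom_def intro: adaptor_cong)

text \<open>The inverse exchanges the two rebracketings, exactly as the dual does. Hence the dual of
  an associator will be the inverse associator at the dual objects; the unitors behave
  likewise.\<close>

lemma inverse_arrows_associator:
  assumes "A \<in> lens_obj" "B \<in> lens_obj" "D \<in> lens_obj"
  shows "inverse_arrows Lens (lens_associator A B D)
    (adaptor (lens_tensor_ob A (lens_tensor_ob B D)) (lens_tensor_ob (lens_tensor_ob A B) D)
      assoc_left assoc_right)"
  unfolding lens_associator_def
  by (rule inverse_arrows_adaptor) (use assms in auto)

lemma inverse_arrows_lunitor: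
  assumes "A \<in> lens_obj"
  shows "inverse_arrows Lens (lens_lunitor A)
    (adaptor A (lens_tensor_ob lens_unit A) (\<lambda>s. pair (pt, s)) (\<lambda>p. snd (unpair p)))"
  unfolding lens_lunitor_def
  by (rule inverse_arrows_adaptor) (use assms in auto)

lemma inverse_arrows_runitor:
  assumes "A \<in> lens_obj"
  shows "inverse_arrows Lens (lens_runitor A)
    (adaptor A (lens_tensor_ob A lens_unit) (\<lambda>s. pair (s, pt)) (\<lambda>p. fst (unpair p)))"
  unfolding lens_runitor_def
  by (rule inverse_arrows_adaptor) (use assms in auto)

lemma associator_hom:
  "\<lbrakk>A \<in> lens_obj; B \<in> lens_obj; D \<in> lens_obj\<rbrakk> \<Longrightarrow> lens_associator A B D \<in>
     hom Lens (lens_tensor_ob (lens_tensor_ob A B) D) (lens_tensor_ob A (lens_tensor_ob B D))"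
  unfolding lens_associator_def by (rule adaptor_hom) auto

lemma lunitor_hom:
  "A \<in> lens_obj \<Longrightarrow> lens_lunitor A \<in> hom Lens (lens_tensor_ob lens_unit A) A"
  unfolding lens_lunitor_def by (rule adaptor_hom) auto

lemma runitor_hom:
  "A \<in> lens_obj \<Longrightarrow> lens_runitor A \<in> hom Lens (lens_tensor_ob A lens_unit) A"
  unfolding lens_runitor_def by (rule adaptor_hom) auto

lemma symmetry_hom:
  "\<lbrakk>A \<in> lens_obj; B \<in> lens_obj\<rbrakk> \<Longrightarrow>
     lens_symmetry A B \<in> hom Lens (lens_tensor_ob A B) (lens_tensor_ob B A)"
  unfolding lens_symmetry_def by (rule adaptor_hom) auto

lemmas structure_defs =
  lens_associator_def lens_lunitor_def lens_runitor_def lens_symmetry_def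

text \<open>Pointwise values for the naturality squares and the counit of a tensor, where structure
  arrows meet lenses that need not be adaptors.\<close>

lemma structure_simps:
  "x \<in> fst A \<Longrightarrow> view (lens_id A) x = x"
  "x \<in> fst A \<Longrightarrow> s \<in> snd A \<Longrightarrow> upd (lens_id A) (x, s) = s"
  "p \<in> pair ` (pair ` (fst A \<times> fst B) \<times> fst D) \<Longrightarrow>
     view (lens_associator A B D) p = assoc_right p"
  "p \<in> pair ` (pair ` (fst A \<times> fst B) \<times> fst D) \<Longrightarrow>
     q \<in> pair ` (snd A \<times> pair ` (snd B \<times> snd D)) \<Longrightarrow>
     upd (lens_associator A B D) (p, q) = assoc_left q"
  "x \<in> fst A \<Longrightarrow> view (lens_lunitor A) (pair (pt, x)) = x"
  "x \<in> fst A \<Longrightarrow> s \<in> snd A \<Longrightarrow> upd (lens_lunitor A) (pair (pt, x), s) = pair (pt, s)"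
  "x \<in> fst A \<Longrightarrow> view (lens_runitor A) (pair (x, pt)) = x"
  "x \<in> fst A \<Longrightarrow> s \<in> snd A \<Longrightarrow> upd (lens_runitor A) (pair (x, pt), s) = pair (s, pt)"
  "p \<in> pair ` (fst A \<times> fst B) \<Longrightarrow> view (lens_symmetry A B) p = swap p"
  "p \<in> pair ` (fst A \<times> fst B) \<Longrightarrow> q \<in> pair ` (snd B \<times> snd A) \<Longrightarrow>
     upd (lens_symmetry A B) (p, q) = swap q"
  by (auto simp: structure_defs id_adaptor)


subsection \<open>The symmetric monoidal category of lenses\<close>

lemma category_Lens: "category Lens"
proof (unfold_locales, unfold Lens_simps)
  fix A B D E f g h
  { assume "f \<in> lens_arr" then show "src f \<in> lens_obj" by (simp add: lens_arr_def) }
  { assume "f \<in> lens_arr" then show "tgt f \<in> lens_obj" by (simp add: lens_arr_def) }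
  { assume "A \<in> lens_obj" then show "lens_id A \<in> hom Lens A A" by (rule id_hom) }
  assume f: "f \<in> hom Lens A B"
  note o = hom_simps(1,2)[OF f]
  show "lens_comp (lens_id B) f = f"
    by (rule hom_eqI[OF comp_hom[OF f id_hom] f])
      (auto simp: o comp_simps[OF f id_hom] hom_simps[OF f] structure_simps)
  show "lens_comp f (lens_id A) = f"
    by (rule hom_eqI[OF comp_hom[OF id_hom f] f])
      (auto simp: o comp_simps[OF id_hom f] hom_simps[OF f] structure_simps)
  assume g: "g \<in> hom Lens B D"
  show "lens_comp g f \<in> hom Lens A D"
    by (rule comp_hom[OF f g])
  assume h: "h \<in> hom Lens D E"
  \<comment> \<open>On both sides the feedback passes back through \<open>h\<close>,
    \<open>g\<close> and \<open>f\<close>, each update taken at the point that the earlier views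
    have reached.\<close>
  show "lens_comp (lens_comp h g) f = lens_comp h (lens_comp g f)"
    by (rule hom_eqI[OF comp_hom[OF f comp_hom[OF g h]] comp_hom[OF comp_hom[OF f g] h]])
      (simp_all add: comp_simps[OF f comp_hom[OF g h]] comp_simps[OF comp_hom[OF f g] h]
        comp_simps[OF f g] comp_simps[OF g h] hom_simps[OF f] hom_simps[OF g] hom_simps[OF h])
qed

section \<open>Functoriality of the tensor and naturality of the structure arrows\<close>

lemma tensor_comp:
  assumes f: "f \<in> hom Lens A B" and g: "g \<in> hom Lens B D"
    and f': "f' \<in> hom Lens A' B'" and g': "g' \<in> hom Lens B' D'"
  shows "lens_tensor_ar (lens_comp g f) (lens_comp g' f') =
    lens_comp (lens_tensor_ar g g') (lens_tensor_ar f f')"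
  by (rule hom_eqI[OF tensor_ar_hom[OF comp_hom[OF f g] comp_hom[OF f' g']]
        comp_hom[OF tensor_ar_hom[OF f f'] tensor_ar_hom[OF g g']]])
    (auto simp: comp_simps[OF tensor_ar_hom[OF f f'] tensor_ar_hom[OF g g']]
      tensor_ar_simps[OF comp_hom[OF f g] comp_hom[OF f' g']]
      tensor_ar_simps[OF f f'] tensor_ar_simps[OF g g'] comp_simps[OF f g] comp_simps[OF f' g']
      hom_simps[OF f] hom_simps[OF f'] hom_simps[OF g] hom_simps[OF g'])

lemma associator_natural:
  assumes f: "f \<in> hom Lens A A'" and g: "g \<in> hom Lens B B'" and h: "h \<in> hom Lens D D'"
  shows "lens_comp (lens_associator A' B' D') (lens_tensor_ar (lens_tensor_ar f g) h) =
    lens_comp (lens_tensor_ar f (lens_tensor_ar g h)) (lens_associator A B D)"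
proof -
  \<comment> \<open>The objects in the hypotheses of \<open>comp_simps\<close> and
    \<open>tensor_ar_simps\<close> do not occur in their equations, so the typing of each composite
    is fixed first.\<close>
  note fg = tensor_ar_hom[OF f g] and gh = tensor_ar_hom[OF g h]
  note l = tensor_ar_hom[OF fg h] and r = tensor_ar_hom[OF f gh]
  note a = associator_hom[OF hom_simps(1)[OF f] hom_simps(1)[OF g] hom_simps(1)[OF h]]
    and a' = associator_hom[OF hom_simps(2)[OF f] hom_simps(2)[OF g] hom_simps(2)[OF h]]
  show ?thesis
    by (rule hom_eqI[OF comp_hom[OF l a'] comp_hom[OF a r]])
      (auto simp: comp_simps[OF l a'] comp_simps[OF a r] tensor_ar_simps[OF f g]
        tensor_ar_simps[OF g h] tensor_ar_simps[OF fg h] tensor_ar_simps[OF f gh]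
        hom_simps[OF f] hom_simps[OF g] hom_simps[OF h] structure_simps)
qed

lemma lunitor_natural:
  assumes f: "f \<in> hom Lens A B"
  shows "lens_comp (lens_lunitor B) (lens_tensor_ar (lens_id lens_unit) f) =
    lens_comp f (lens_lunitor A)"
proof -
  note i = id_hom[OF obj_closed(1)]
  note l = tensor_ar_hom[OF i f]
  note a = lunitor_hom[OF hom_simps(1)[OF f]] and a' = lunitor_hom[OF hom_simps(2)[OF f]]
  show ?thesis
    by (rule hom_eqI[OF comp_hom[OF l a'] comp_hom[OF a f]])
      (auto simp: comp_simps[OF l a'] comp_simps[OF a f] tensor_ar_simps[OF i f]
        hom_simps[OF f] structure_simps)
qed

lemma runitor_natural:
  assumes f: "f \<in> hom Lens A B"
  shows "lens_comp (lens_runitor B) (lens_tensor_ar f (lens_id lens_unit)) =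
    lens_comp f (lens_runitor A)"
proof -
  note i = id_hom[OF obj_closed(1)]
  note l = tensor_ar_hom[OF f i]
  note a = runitor_hom[OF hom_simps(1)[OF f]] and a' = runitor_hom[OF hom_simps(2)[OF f]]
  show ?thesis
    by (rule hom_eqI[OF comp_hom[OF l a'] comp_hom[OF a f]])
      (auto simp: comp_simps[OF l a'] comp_simps[OF a f] tensor_ar_simps[OF f i]
        hom_simps[OF f] structure_simps)
qed

lemma symmetry_natural:
  assumes f: "f \<in> hom Lens A A'" and g: "g \<in> hom Lens B B'"
  shows "lens_comp (lens_symmetry A' B') (lens_tensor_ar f g) =
    lens_comp (lens_tensor_ar g f) (lens_symmetry A B)"
proof -
  note l = tensor_ar_hom[OF f g] and r = tensor_ar_hom[OF g f]
  note a = symmetry_hom[OF hom_simps(1)[OF f] hom_simps(1)[OF g]]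
    and a' = symmetry_hom[OF hom_simps(2)[OF f] hom_simps(2)[OF g]]
  show ?thesis
    by (rule hom_eqI[OF comp_hom[OF l a'] comp_hom[OF a r]])
      (auto simp: comp_simps[OF l a'] comp_simps[OF a r] tensor_ar_simps[OF f g]
        tensor_ar_simps[OF g f] hom_simps[OF f] hom_simps[OF g] structure_simps)
qed

text \<open>Turns the typing conditions of \<open>comp_adaptor\<close> on tensor objects into
  conditions on explicit pairs, on which the rearrangements compute.\<close>

lemma Pi_image_pair:
  "h \<in> pair ` (X \<times> Y) \<rightarrow> Z \<longleftrightarrow> (\<forall>x\<in>X. \<forall>y\<in>Y. h (pair (x, y)) \<in> Z)"
  by auto

lemma symmetric_monoidal_category_Lens: "symmetric_monoidal_category Lens"
proof -
  interpret category Lens by (rule category_Lens)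
  \<comment> \<open>These rules collapse any composite or tensor of structure arrows to a single
    adaptor.\<close>
  note adaptor_calc = structure_defs id_adaptor tensor_adaptor comp_adaptor Pi_image_pair
  show ?thesis
  proof (unfold_locales, unfold Lens_simps)
    fix A B D E
    show "lens_unit \<in> lens_obj" by simp
    assume A: "A \<in> lens_obj"
    show "iso Lens (lens_lunitor A)" "iso Lens (lens_runitor A)"
      unfolding iso_def using inverse_arrows_lunitor[OF A] inverse_arrows_runitor[OF A] by blast+
    show "lens_lunitor A \<in> hom Lens (lens_tensor_ob lens_unit A) A"
      "lens_runitor A \<in> hom Lens (lens_tensor_ob A lens_unit) A"
      using A by (simp_all add: lunitor_hom runitor_hom)
    assume B: "B \<in> lens_obj"
    show "lens_tensor_ob A B \<in> lens_obj" using A B by simp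
    show "lens_symmetry A B \<in> hom Lens (lens_tensor_ob A B) (lens_tensor_ob B A)"
      using A B by (rule symmetry_hom)
    show "lens_tensor_ar (lens_id A) (lens_id B) = lens_id (lens_tensor_ob A B)"
      unfolding adaptor_calc by (rule adaptor_cong) auto
    show "lens_comp (lens_symmetry B A) (lens_symmetry A B) = lens_id (lens_tensor_ob A B)"
      by (auto simp: adaptor_calc intro!: adaptor_cong)
    show "lens_comp (lens_tensor_ar (lens_id A) (lens_lunitor B)) (lens_associator A lens_unit B)
        = lens_tensor_ar (lens_runitor A) (lens_id B)"
      by (auto simp: adaptor_calc intro!: adaptor_cong)
    assume D: "D \<in> lens_obj"
    show "lens_associator A B D \<in>
      hom Lens (lens_tensor_ob (lens_tensor_ob A B) D) (lens_tensor_ob A (lens_tensor_ob B D))"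
      using A B D by (rule associator_hom)
    show "iso Lens (lens_associator A B D)"
      unfolding iso_def using inverse_arrows_associator[OF A B D] by blast
    show "lens_comp (lens_associator B D A)
          (lens_comp (lens_symmetry A (lens_tensor_ob B D)) (lens_associator A B D))
        = lens_comp (lens_tensor_ar (lens_id B) (lens_symmetry A D))
          (lens_comp (lens_associator B A D) (lens_tensor_ar (lens_symmetry A B) (lens_id D)))"
      by (auto simp: adaptor_calc intro!: adaptor_cong)
    assume E: "E \<in> lens_obj"
    show "lens_comp (lens_associator A B (lens_tensor_ob D E))
          (lens_associator (lens_tensor_ob A B) D E)
        = lens_comp (lens_tensor_ar (lens_id A) (lens_associator B D E))
          (lens_comp (lens_associator A (lens_tensor_ob B D) E)
            (lens_tensor_ar (lens_associator A B D) (lens_id E)))"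
      by (auto simp: adaptor_calc intro!: adaptor_cong)
  qed (fact tensor_ar_hom tensor_comp associator_natural lunitor_natural runitor_natural
      symmetry_natural)+
qed


subsection \<open>Duality and counits\<close>

text \<open>For f = (h, k) both updates send (x, r) to (k r, h x): the left side applies h before
  the swap and k after it, the right side k before and h after. Both views are constant.\<close>

lemma counit_extranatural:
  assumes "f \<in> adaptors" and f: "f \<in> hom Lens A B"
  shows "lens_comp (lens_counit B) (lens_tensor_ar f (lens_id (lens_dual_ob B))) =
    lens_comp (lens_counit A) (lens_tensor_ar (lens_id A) (lens_dual_ar f))"
proof -
  obtain h k where ob: "A \<in> lens_obj" "B \<in> lens_obj" and h: "h \<in> fst A \<rightarrow> fst B"
    and k: "k \<in> snd B \<rightarrow> snd A" and eq: "f = adaptor A B h k"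
    using assms by (auto simp: hom_iff elim!: adaptorsE)
  have *: "lens_tensor_ar f (lens_id (lens_dual_ob B)) =
      adaptor (lens_tensor_ob A (lens_dual_ob B)) (lens_tensor_ob B (lens_dual_ob B))
        (cross h (\<lambda>x. x)) (cross k (\<lambda>x. x))"
    "lens_tensor_ar (lens_id A) (lens_dual_ar f) =
      adaptor (lens_tensor_ob A (lens_dual_ob B)) (lens_tensor_ob A (lens_dual_ob A))
        (cross (\<lambda>x. x) k) (cross (\<lambda>x. x) h)"
    using ob h k by (simp_all add: eq id_adaptor dual_adaptor tensor_adaptor)
  show ?thesis
    unfolding * using h k
    by (auto simp: lens_comp_def lens_counit_def Let_def intro!: restrict_ext)
qed

text \<open>The symmetry swaps on the way forward and again on the way back; with the swap of the
  counit in between, three swaps amount to one.\<close>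

lemma counit_dual:
  "lens_counit (lens_dual_ob A) = lens_comp (lens_counit A) (lens_symmetry (lens_dual_ob A) A)"
  by (auto simp: lens_comp_def lens_counit_def lens_symmetry_def Let_def intro!: restrict_ext)

text \<open>Transposition of a two-by-two array. Being an involution, it serves as the forward and
  as the backward function of the middle exchange.\<close>

definition exchange :: "'u \<Rightarrow> 'u" where
  "exchange p = (case unpair p of (q, q') \<Rightarrow> case (unpair q, unpair q') of
     ((a, b), (a', b')) \<Rightarrow> pair (pair (a, a'), pair (b, b')))"

lemma exchange_pair [simp]:
  "exchange (pair (pair (a, b), pair (a', b'))) = pair (pair (a, a'), pair (b, b'))"
  by (simp add: exchange_def)

lemma middle_exchange_Lens:
  assumes "A \<in> lens_obj" "B \<in> lens_obj" "A' \<in> lens_obj" "B' \<in> lens_obj"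
  shows "middle_exchange Lens A B A' B' =
    adaptor (lens_tensor_ob (lens_tensor_ob A B) (lens_tensor_ob A' B'))
      (lens_tensor_ob (lens_tensor_ob A A') (lens_tensor_ob B B')) exchange exchange"
proof -
  interpret category Lens by (rule category_Lens)
  show ?thesis
    using assms
    by (auto simp: middle_exchange_def
        \<comment> \<open>The associators are themselves rewritten to adaptors, so the rule for
          their inverses has to be stated for the unfolded form.\<close>
        inv_ar_eq[OF inverse_arrows_associator[unfolded structure_defs]] structure_defs
        id_adaptor tensor_adaptor comp_adaptor Pi_image_pair intro!: adaptor_cong)
qed

text \<open>On ((x, y), (s, t)) the right side exchanges to ((x, s), (y, t)), swaps inside each
  factor to ((s, x), (t, y)), and exchanges back to ((s, t), (x, y)), which is the swap on the left.
  The unitor only duplicates the feedback \<open>pt\<close>.\<close>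

lemma counit_tensor:
  assumes A: "A \<in> lens_obj" and B: "B \<in> lens_obj"
  shows "lens_counit (lens_tensor_ob A B) =
    lens_comp (lens_lunitor lens_unit)
      (lens_comp (lens_tensor_ar (lens_counit A) (lens_counit B))
        (middle_exchange Lens A B (lens_dual_ob A) (lens_dual_ob B)))"
proof -
  let ?m = "adaptor
    (lens_tensor_ob (lens_tensor_ob A B) (lens_tensor_ob (lens_dual_ob A) (lens_dual_ob B)))
    (lens_tensor_ob (lens_tensor_ob A (lens_dual_ob A)) (lens_tensor_ob B (lens_dual_ob B)))
    exchange exchange"
  have m: "?m \<in> hom Lens
    (lens_tensor_ob (lens_tensor_ob A B) (lens_tensor_ob (lens_dual_ob A) (lens_dual_ob B)))
    (lens_tensor_ob (lens_tensor_ob A (lens_dual_ob A)) (lens_tensor_ob B (lens_dual_ob B)))"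
    using A B by (intro adaptor_hom) auto
  note a = counit_hom[OF A] and b = counit_hom[OF B]
  note ab = tensor_ar_hom[OF a b] and l = lunitor_hom[OF obj_closed(1)]
  \<comment> \<open>The source of \<open>c\<close> contains the dual of a tensor, that of the
    composite a tensor of duals; \<open>dual_ob_simps\<close> reconciles them when \<open>c\<close>
    is used.\<close>
  note c = counit_hom[OF obj_closed(2)[OF A B]]
  show ?thesis
    unfolding middle_exchange_Lens[OF A B obj_closed(3)[OF A] obj_closed(3)[OF B]]
    by (rule hom_eqI[OF _ comp_hom[OF comp_hom[OF m ab] l]])
      (use c in \<open>auto simp: comp_simps[OF comp_hom[OF m ab] l] comp_simps[OF m ab]
        tensor_ar_simps[OF a b] counit_simps structure_simps\<close>)
qed

lemma teleological_category_Lens: "teleological_category Lens"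
proof -
  interpret symmetric_monoidal_category Lens by (rule symmetric_monoidal_category_Lens)
  note adaptor_calc = structure_defs id_adaptor tensor_adaptor comp_adaptor dual_adaptor
    Pi_image_pair
  note invs =
    inv_ar_eq[OF inverse_arrows_associator[unfolded structure_defs]]
    inv_ar_eq[OF inverse_arrows_lunitor[unfolded structure_defs]]
    inv_ar_eq[OF inverse_arrows_runitor[unfolded structure_defs]]
  show ?thesis
  proof (unfold_locales, unfold Lens_simps)
    show "adaptors \<subseteq> lens_arr" by (auto simp: adaptors_def)
    show "lens_dual_ob lens_unit = lens_unit" by simp
  next
    fix f g assume f: "f \<in> adaptors"
    then show "lens_dual_ar f \<in> adaptors"
      by (elim adaptorsE) (simp add: dual_adaptor adaptor_in_adaptors)
    show "lens_dual_ar (lens_dual_ar f) = f"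
      using f by (elim adaptorsE) (simp add: dual_adaptor)
    { fix A B assume "f \<in> hom Lens A B"
      then show "lens_dual_ar f \<in> hom Lens (lens_dual_ob B) (lens_dual_ob A)"
        using f by (elim adaptorsE) (simp add: hom_def[of Lens A B] dual_adaptor adaptor_hom) }
    assume g: "g \<in> adaptors"
    show "lens_tensor_ar f g \<in> adaptors"
      using f g by (elim adaptorsE) (auto simp: tensor_adaptor Pi_iff intro!: adaptor_in_adaptors)
    show "lens_dual_ar (lens_tensor_ar f g) = lens_tensor_ar (lens_dual_ar f) (lens_dual_ar g)"
      using f g by (elim adaptorsE) (auto simp: adaptor_calc Pi_iff)
    assume "tgt f = src g"
    then show "lens_comp g f \<in> adaptors"
      and "lens_dual_ar (lens_comp g f) = lens_comp (lens_dual_ar f) (lens_dual_ar g)"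
      using f g by (auto elim!: adaptorsE intro!: adaptor_in_adaptors simp: adaptor_calc Pi_iff)
  next
    fix A assume A: "A \<in> lens_obj"
    show "lens_id A \<in> adaptors"
      "lens_lunitor A \<in> adaptors \<and> inv_ar Lens (lens_lunitor A) \<in> adaptors"
      "lens_runitor A \<in> adaptors \<and> inv_ar Lens (lens_runitor A) \<in> adaptors"
      using A by (auto simp: invs structure_defs id_adaptor intro!: adaptor_in_adaptors)
    show "lens_dual_ob A \<in> lens_obj" "lens_dual_ob (lens_dual_ob A) = A" using A by simp_all
    \<comment> \<open>Taking the dual and taking the inverse both exchange the two functions of a
      unitor, so after rewriting the two sides are the same adaptor.\<close>
    show "lens_dual_ar (lens_id A) = lens_id (lens_dual_ob A)"
      "lens_dual_ar (lens_lunitor A) = inv_ar Lens (lens_lunitor (lens_dual_ob A))"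
      "lens_dual_ar (lens_runitor A) = inv_ar Lens (lens_runitor (lens_dual_ob A))"
      using A by (simp_all add: invs adaptor_calc)
    show "lens_counit (lens_dual_ob A) =
        lens_comp (lens_counit A) (lens_symmetry (lens_dual_ob A) A)"
      by (rule counit_dual)
    fix B assume B: "B \<in> lens_obj"
    show "lens_symmetry A B \<in> adaptors"
      using A B by (auto simp: structure_defs intro!: adaptor_in_adaptors)
    show "lens_dual_ob (lens_tensor_ob A B) = lens_tensor_ob (lens_dual_ob A) (lens_dual_ob B)"
      by simp
    show "lens_dual_ar (lens_symmetry A B) = lens_symmetry (lens_dual_ob B) (lens_dual_ob A)"
      using A B by (simp add: adaptor_calc)
    fix D assume D: "D \<in> lens_obj"
    show "lens_associator A B D \<in> adaptors \<and> inv_ar Lens (lens_associator A B D) \<in> adaptors"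
      using A B D by (auto simp: invs structure_defs intro!: adaptor_in_adaptors)
    show "lens_dual_ar (lens_associator A B D) =
        inv_ar Lens (lens_associator (lens_dual_ob A) (lens_dual_ob B) (lens_dual_ob D))"
      using A B D by (simp add: invs adaptor_calc)
  qed (fact counit_hom counit_extranatural counit_tensor)+
qed

end

theorem proposition5p2:
  fixes U :: "'u set set" and pair :: "'u \<times> 'u \<Rightarrow> 'u" and pt :: 'u
  assumes "set_universe U pair pt"
  shows "teleological_category (set_universe.Lens U pair pt)"
  using assms by (rule set_universe.teleological_category_Lens)

end
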